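(* Let $\boldsymbol{\Sigma}=\{\sigma_{a_1a_2|x_1x_2}\}$ be a tripartite assemblage (two Alices, one Bob) with outcome sets $\mathbb{A}_1,\mathbb{A}_2$, setting sets $\mathbb{X}_1,\mathbb{X}_2$ and Bob's Hilbert space $\mathcal{H}_B$ of finite dimension $d_B$, and let $\boldsymbol{\Sigma}'=\{\sigma'_{a_1'a_2'|x_1'x_2'}\}$ be a tripartite assemblage with outcome sets $\mathbb{A}_1',\mathbb{A}_2'$, setting sets $\mathbb{X}_1',\mathbb{X}_2'$ and Bob's Hilbert space $\mathcal{H}_{B'}$ of finite dimension. Let $\lambda$ range over the finite set of all tuples of functions $(f^1_\lambda,g^1_\lambda,f^2_\lambda,g^2_\lambda)$ with $f^i_\lambda:\mathbb{A}_i\times\mathbb{X}_i'\to\mathbb{A}_i'$ and $g^i_\lambda:\mathbb{X}_i'\to\mathbb{X}_i$, and put $D(a_i'|a_i,x_i',\lambda)=\delta_{a_i',f^i_\lambda(a_i,x_i')}$ and $D(x_i|x_i',\lambda)=\delta_{x_i,g^i_\lambda(x_i')}$ for $i=1,2$. Then $\boldsymbol{\Sigma}$ can be converted into $\boldsymbol{\Sigma}'$ under LOSR operations if and only if the following semidefinite program is feasible: there exist operators $\{W_\lambda\}_\lambda$ on $\mathcal{H}_B\otimes\mathcal{H}_{B'}$ such that $$W_\lambda\ge 0\quad\text{and}\quad \mathrm{tr}_{B'}\{W_\lambda\}\propto \tfrac{1}{d_B}\mathbb{I}_B\quad\text{for all }\lambda,\qquad \sum_\lambda \mathrm{tr}_{B'}\{W_\lambda\}=\tfrac{1}{d_B}\mathbb{I}_B,$$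 and, for all $a_1',a_2',x_1',x_2'$, $$\sigma'_{a_1'a_2'|x_1'x_2'}=\sum_\lambda\sum_{a_1,a_2,x_1,x_2} D(a_1'|a_1,x_1',\lambda)\,D(x_1|x_1',\lambda)\,D(a_2'|a_2,x_2',\lambda)\,D(x_2|x_2',\lambda)\; d_B\,\mathrm{tr}_B\{W_\lambda(\mathbb{I}_{B'}\otimes\sigma_{a_1a_2|x_1x_2}^{T})\}.$$
   Context: All label sets are finite. A tripartite assemblage (two Alices, one Bob) is a collection of (unnormalised) positive semidefinite operators $\sigma_{a_1a_2|x_1x_2}$ on $\mathcal{H}_B$, $a_i\in\mathbb{A}_i$, $x_i\in\mathbb{X}_i$, of the form $\sigma_{a_1a_2|x_1x_2}=\mathrm{tr}_{A_1A_2}\{(M^{(1)}_{a_1|x_1}\otimes M^{(2)}_{a_2|x_2}\otimes\mathbb{I})\rho\}$ for some Hilbert spaces $\mathcal{H}_{A_1},\mathcal{H}_{A_2}$, density operator $\rho$ on $\mathcal{H}_{A_1}\otimes\mathcal{H}_{A_2}\otimes\mathcal{H}_B$, and POVMs $\{M^{(i)}_{a_i|x_i}\}_{a_i}$ on $\mathcal{H}_{A_i}$, one for each $x_i$. LOSR (local operations and shared randomness) conversion: $\boldsymbol{\Sigma}$ can be converted into $\boldsymbol{\Sigma}'$ under LOSR operations if there exist finite-valued classical variables $\lambda,c_1,c_2$, a probability distribution $p(\lambda)$, conditional probability distributions $p(c_i,x_i|x_i',\lambda)$ and $p(a_i'|a_i,c_i)$ for $i=1,2$, and completely positive trace-preserving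 maps $\mathcal{E}_\lambda$ from operators on $\mathcal{H}_B$ to operators on $\mathcal{H}_{B'}$, such that for all $a_1',a_2',x_1',x_2'$ $$\sigma'_{a_1'a_2'|x_1'x_2'}=\sum_{\lambda,c_1,c_2}\sum_{a_1,a_2,x_1,x_2}p(\lambda)\,p(c_1,x_1|x_1',\lambda)\,p(c_2,x_2|x_2',\lambda)\,p(a_1'|a_1,c_1)\,p(a_2'|a_2,c_2)\,\mathcal{E}_\lambda(\sigma_{a_1a_2|x_1x_2}).$$ Here $T$ denotes the transpose in a fixed orthonormal basis of $\mathcal{H}_B$, and in $W_\lambda(\mathbb{I}_{B'}\otimes\sigma^T)$ the factor $\sigma^T$ acts on $\mathcal{H}_B$ and the identity acts on $\mathcal{H}_{B'}$. "$\propto$" means equal up to a scalar factor (which may depend on $\lambda$). *)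

theory Defs
  imports "HOL-Analysis.Analysis"
begin

text \<open>
  The Hilbert spaces of the Alices are arbitrary, possibly infinite-dimensional, so they are
  modelled as \<open>\<ell>\<^sup>2('h)\<close> for an arbitrary index type \<open>'h\<close> (an orthonormal basis), and an operator is
  given by its matrix elements, a kernel \<open>'h \<Rightarrow> 'h \<Rightarrow> complex\<close> (row index first).  Bob's
  finite-dimensional spaces are \<open>complex ^ 'b\<close>, with operators \<open>complex ^ 'b ^ 'b\<close>.
\<close>

type_synonym 'h kernel = "'h \<Rightarrow> 'h \<Rightarrow> complex"

text \<open>
  Positive semidefiniteness on the span of the basis vectors in \<open>S\<close>.  It is tested on finitely
  supported vectors, which is equivalent to positivity of the operator whenever the kernel
  defines a bounded one.
\<close>

definition psd_on :: "'h set \<Rightarrow> 'h kernel \<Rightarrow> bool" where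
  "psd_on S A \<longleftrightarrow>
     (\<forall>F v. finite F \<and> F \<subseteq> S \<longrightarrow>
        (\<Sum>i\<in>F. \<Sum>j\<in>F. cnj (v i) * A i j * v j) \<in> \<real>\<^sub>\<ge>\<^sub>0)"

definition op_id :: "'h kernel" where
  "op_id = (\<lambda>i j. if i = j then 1 else 0)"

definition op_mult :: "'h kernel \<Rightarrow> 'h kernel \<Rightarrow> 'h kernel" where
  "op_mult A B = (\<lambda>i j. \<Sum>\<^sub>\<infinity>k. A i k * B k j)"

definition op_tensor :: "'h kernel \<Rightarrow> 'k kernel \<Rightarrow> ('h \<times> 'k) kernel" where
  "op_tensor A B = (\<lambda>(i, k) (j, l). A i j * B k l)"

text \<open>
  A positive kernel with summable diagonal is Hilbert--Schmidt, hence bounded, and is then the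
  matrix of a positive trace-class operator.
\<close>

definition density_operator :: "'h kernel \<Rightarrow> bool" where
  "density_operator \<rho> \<longleftrightarrow> psd_on UNIV \<rho> \<and> ((\<lambda>i. \<rho> i i) has_sum 1) UNIV"

text \<open>Boundedness is automatic: positivity and summation to the identity give \<open>0 \<le> M a \<le> 1\<close>.\<close>

definition povm :: "('a::finite \<Rightarrow> 'h kernel) \<Rightarrow> bool" where
  "povm M \<longleftrightarrow> (\<forall>a. psd_on UNIV (M a)) \<and> (\<forall>i j. (\<Sum>a\<in>UNIV. M a i j) = op_id i j)"

definition partial_trace_alices :: "('h1 \<times> 'h2 \<times> 'b) kernel \<Rightarrow> complex ^ 'b ^ 'b" where
  "partial_trace_alices X = (\<chi> k l. \<Sum>\<^sub>\<infinity>(i, j). X (i, j, k) (i, j, l))"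

definition psd :: "complex ^ 'b ^ 'b \<Rightarrow> bool" where
  "psd A \<longleftrightarrow> psd_on UNIV (\<lambda>i j. A $ i $ j)"

text \<open>
  The Hilbert spaces of the Alices appear through the index types \<open>'h1\<close> and \<open>'h2\<close>, because a
  predicate cannot quantify existentially over types.  As a hypothesis, with \<open>'h1\<close> and \<open>'h2\<close>
  schematic, it says that there are some such spaces.
\<close>

definition tripartite_assemblage ::
  "'h1 itself \<Rightarrow> 'h2 itself \<Rightarrow>
   ('a1::finite \<Rightarrow> 'a2::finite \<Rightarrow> 'x1::finite \<Rightarrow> 'x2::finite \<Rightarrow> complex ^ 'b ^ 'b) \<Rightarrow> bool" where
  "tripartite_assemblage (_ :: 'h1 itself) (_ :: 'h2 itself) \<sigma> \<longleftrightarrow>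
     (\<forall>a1 a2 x1 x2. psd (\<sigma> a1 a2 x1 x2)) \<and>
     (\<exists>(\<rho> :: ('h1 \<times> 'h2 \<times> 'b) kernel)
       (M1 :: 'x1 \<Rightarrow> 'a1 \<Rightarrow> 'h1 kernel) (M2 :: 'x2 \<Rightarrow> 'a2 \<Rightarrow> 'h2 kernel).
        density_operator \<rho> \<and> (\<forall>x1. povm (M1 x1)) \<and> (\<forall>x2. povm (M2 x2)) \<and>
        (\<forall>a1 a2 x1 x2. \<sigma> a1 a2 x1 x2 =
           partial_trace_alices
             (op_mult (op_tensor (M1 x1 a1) (op_tensor (M2 x2 a2) op_id)) \<rho>)))"

definition mat_tensor :: "complex ^ 'b ^ 'b \<Rightarrow> complex ^ 'c ^ 'c \<Rightarrow> complex ^ ('b \<times> 'c) ^ ('b \<times> 'c)" where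
  "mat_tensor A B = (\<chi> p q. A $ fst p $ fst q * B $ snd p $ snd q)"

definition trace_fst :: "complex ^ ('b::finite \<times> 'c::finite) ^ ('b \<times> 'c) \<Rightarrow> complex ^ 'c ^ 'c" where
  "trace_fst X = (\<chi> k l. \<Sum>i\<in>UNIV. X $ (i, k) $ (i, l))"

definition trace_snd :: "complex ^ ('b::finite \<times> 'c::finite) ^ ('b \<times> 'c) \<Rightarrow> complex ^ 'b ^ 'b" where
  "trace_snd X = (\<chi> i j. \<Sum>k\<in>UNIV. X $ (i, k) $ (j, k))"

definition cscale :: "complex \<Rightarrow> complex ^ 'b ^ 'b \<Rightarrow> complex ^ 'b ^ 'b" where
  "cscale c A = map_matrix ((*) c) A"

definition clinear_map :: "(complex ^ 'b ^ 'b \<Rightarrow> complex ^ 'c ^ 'c) \<Rightarrow> bool" where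
  "clinear_map E \<longleftrightarrow> (\<forall>A B. E (A + B) = E A + E B) \<and> (\<forall>c A. E (cscale c A) = cscale c (E A))"

text \<open>
  The map \<open>id \<otimes> E\<close>; restricted to indices whose first component lies in \<open>{..<n}\<close>, it acts on
  operators on the tensor product of the \<open>n\<close>-dimensional space with \<open>complex ^ 'b\<close>.
\<close>

definition ampliation ::
  "(complex ^ 'b ^ 'b \<Rightarrow> complex ^ 'c ^ 'c) \<Rightarrow> (nat \<times> 'b) kernel \<Rightarrow> (nat \<times> 'c) kernel" where
  "ampliation E X = (\<lambda>(m, k) (n, l). E (\<chi> i j. X (m, i) (n, j)) $ k $ l)"

definition completely_positive :: "(complex ^ 'b ^ 'b \<Rightarrow> complex ^ 'c ^ 'c) \<Rightarrow> bool" where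
  "completely_positive E \<longleftrightarrow> clinear_map E \<and>
     (\<forall>n X. psd_on ({..<n} \<times> UNIV) X \<longrightarrow> psd_on ({..<n} \<times> UNIV) (ampliation E X))"

definition cptp :: "(complex ^ 'b ^ 'b \<Rightarrow> complex ^ 'c ^ 'c) \<Rightarrow> bool" where
  "cptp E \<longleftrightarrow> completely_positive E \<and> (\<forall>A. trace (E A) = trace A)"

definition prob_dist_on :: "'s set \<Rightarrow> ('s \<Rightarrow> real) \<Rightarrow> bool" where
  "prob_dist_on S p \<longleftrightarrow> (\<forall>s\<in>S. 0 \<le> p s) \<and> sum p S = 1"

text \<open>
  The finite ranges \<open>L\<close>, \<open>C1\<close>, \<open>C2\<close> of the variables \<open>\<lambda>\<close>, \<open>c\<^sub>1\<close>, \<open>c\<^sub>2\<close> are taken to be sets of natural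
  numbers.  Here \<open>q1 x1' l (c1, x1)\<close> stands for \<open>p(c\<^sub>1, x\<^sub>1 | x\<^sub>1', \<lambda>)\<close> and \<open>r1 a1 c1 a1'\<close> for
  \<open>p(a\<^sub>1' | a\<^sub>1, c\<^sub>1)\<close>.
\<close>

definition LOSR_convertible ::
  "('a1::finite \<Rightarrow> 'a2::finite \<Rightarrow> 'x1::finite \<Rightarrow> 'x2::finite \<Rightarrow> complex ^ 'b ^ 'b) \<Rightarrow>
   ('a1'::finite \<Rightarrow> 'a2'::finite \<Rightarrow> 'x1'::finite \<Rightarrow> 'x2'::finite \<Rightarrow> complex ^ 'c ^ 'c) \<Rightarrow> bool" where
  "LOSR_convertible \<sigma> \<sigma>' \<longleftrightarrow>
     (\<exists>(L :: nat set) (C1 :: nat set) (C2 :: nat set) (p :: nat \<Rightarrow> real)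
       (q1 :: 'x1' \<Rightarrow> nat \<Rightarrow> nat \<times> 'x1 \<Rightarrow> real) (q2 :: 'x2' \<Rightarrow> nat \<Rightarrow> nat \<times> 'x2 \<Rightarrow> real)
       (r1 :: 'a1 \<Rightarrow> nat \<Rightarrow> 'a1' \<Rightarrow> real) (r2 :: 'a2 \<Rightarrow> nat \<Rightarrow> 'a2' \<Rightarrow> real)
       (E :: nat \<Rightarrow> complex ^ 'b ^ 'b \<Rightarrow> complex ^ 'c ^ 'c).
        finite L \<and> finite C1 \<and> finite C2 \<and>
        prob_dist_on L p \<and>
        (\<forall>x1'. \<forall>l\<in>L. prob_dist_on (C1 \<times> UNIV) (q1 x1' l)) \<and>
        (\<forall>x2'. \<forall>l\<in>L. prob_dist_on (C2 \<times> UNIV) (q2 x2' l)) \<and>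
        (\<forall>a1. \<forall>c1\<in>C1. prob_dist_on UNIV (r1 a1 c1)) \<and>
        (\<forall>a2. \<forall>c2\<in>C2. prob_dist_on UNIV (r2 a2 c2)) \<and>
        (\<forall>l\<in>L. cptp (E l)) \<and>
        (\<forall>a1' a2' x1' x2'. \<sigma>' a1' a2' x1' x2' =
           (\<Sum>l\<in>L. \<Sum>c1\<in>C1. \<Sum>c2\<in>C2.
            \<Sum>a1\<in>UNIV. \<Sum>a2\<in>UNIV. \<Sum>x1\<in>UNIV. \<Sum>x2\<in>UNIV.
              (p l * q1 x1' l (c1, x1) * q2 x2' l (c2, x2) * r1 a1 c1 a1' * r2 a2 c2 a2')
                *\<^sub>R E l (\<sigma> a1 a2 x1 x2))))"

text \<open>A deterministic local strategy \<open>(f, g)\<close> of one Alice.\<close>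

type_synonym ('a, 'x, 'a', 'x') strategy = "('a \<times> 'x' \<Rightarrow> 'a') \<times> ('x' \<Rightarrow> 'x)"

definition D_outcome :: "('a, 'x, 'a', 'x') strategy \<Rightarrow> 'a' \<Rightarrow> 'a \<Rightarrow> 'x' \<Rightarrow> real" where
  "D_outcome s a' a x' = (if a' = fst s (a, x') then 1 else 0)"

definition D_setting :: "('a, 'x, 'a', 'x') strategy \<Rightarrow> 'x \<Rightarrow> 'x' \<Rightarrow> real" where
  "D_setting s x x' = (if x = snd s x' then 1 else 0)"

end

(*
  A local box p(c,x|x') p(a'|a,c) of one Alice is a mixture of deterministic strategies (f,g):
  the weight of (f,g) is the product over x' of the probabilities that the box chooses the
  setting g(x') and the response function f(-,x'), all responses drawn independently given c.
  Bob's channels are encoded by their Choi matrices, which are positive with marginal the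
  identity.  Hence W_\<lambda> is the mixture of the Choi matrices, weighted by the probability of
  the strategy \<lambda>, divided by d_B.  Conversely, tr_{B'} W_\<lambda> = t_\<lambda> I / d_B makes
  (d_B / t_\<lambda>) W_\<lambda> a Choi matrix and t a probability distribution; complete positivity
  of the induced map follows since a product of Gram representations is a Gram representation.
*)

theory Submission
  imports Defs
begin

section \<open>Positive semidefinite kernels on finite sets\<close>

lemma nonneg_Reals_sum:
  "(\<And>i. i \<in> S \<Longrightarrow> f i \<in> \<real>\<^sub>\<ge>\<^sub>0) \<Longrightarrow> sum f S \<in> (\<real>\<^sub>\<ge>\<^sub>0 :: complex set)"
  by (induction S rule: infinite_finite_induct) auto

lemma sum_swap3:
  "(\<Sum>i\<in>A. \<Sum>j\<in>B. \<Sum>r\<in>C. f i j r) = (\<Sum>r\<in>C. \<Sum>i\<in>A. \<Sum>j\<in>B. f i j r)"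
proof -
  have "(\<Sum>i\<in>A. \<Sum>j\<in>B. \<Sum>r\<in>C. f i j r) = (\<Sum>i\<in>A. \<Sum>r\<in>C. \<Sum>j\<in>B. f i j r)"
    by (intro sum.cong refl sum.swap)
  also have "\<dots> = (\<Sum>r\<in>C. \<Sum>i\<in>A. \<Sum>j\<in>B. f i j r)"
    by (rule sum.swap)
  finally show ?thesis .
qed

lemma psd_on_mono: "psd_on T A \<Longrightarrow> S \<subseteq> T \<Longrightarrow> psd_on S A"
  unfolding psd_on_def by blast

section \<open>Consequences of testing positivity on vectors with at most two entries\<close>

lemma psd_on_diag:
  assumes "psd_on S A" "i \<in> S"
  shows "A i i \<in> \<real>\<^sub>\<ge>\<^sub>0"
  using assms(1)[unfolded psd_on_def, rule_format, of "{i}" "\<lambda>_. 1"] assms(2) by simp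

lemma psd_on_pair:
  assumes "psd_on S A" "i \<in> S" "j \<in> S" "i \<noteq> j"
  shows "cnj a * A i i * a + cnj a * A i j * b + (cnj b * A j i * a + cnj b * A j j * b) \<in> \<real>\<^sub>\<ge>\<^sub>0"
  using assms(1)[unfolded psd_on_def, rule_format, of "{i,j}" "\<lambda>k. if k = i then a else b"] assms(2-)
  by simp

text \<open>Polarisation: the form is real at the vectors with entries \<open>(1, 1)\<close> and
  \<open>(1, \<i>)\<close>. The first forces the imaginary parts of the two off-diagonal entries to
  be opposite, the second forces their real parts to agree.\<close>

lemma psd_on_hermitian:
  assumes "psd_on S A" "i \<in> S" "j \<in> S"
  shows "A j i = cnj (A i j)"
proof (cases "i = j")
  case True
  with psd_on_diag[OF assms(1,2)] show ?thesis
    by (simp add: complex_nonneg_Reals_iff complex_eq_iff)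
next
  case False
  from psd_on_diag[OF assms(1,2)] psd_on_diag[OF assms(1,3)]
    psd_on_pair[OF assms False, of 1 1] psd_on_pair[OF assms False, of 1 \<i>]
  show ?thesis
    by (simp add: complex_nonneg_Reals_iff complex_eq_iff)
qed

text \<open>With no quadratic term at \<open>i\<close>, the form is affine in the entry placed
  there, so a nonzero \<open>A i j\<close> would let it become negative.\<close>

lemma psd_on_zero_diag:
  assumes "psd_on S A" "i \<in> S" "j \<in> S" "A i i = 0"
  shows "A i j = 0"
proof (cases "i = j")
  case False
  define z where "z = A i j"
  define N where "N = Re z ^ 2 + Im z ^ 2"
  have ji: "A j i = cnj z"
    using psd_on_hermitian[OF assms(1-3)] by (simp add: z_def)
  have *: "2 * s * N \<le> Re (A j j)" for s
    using psd_on_pair[OF assms(1-3) False, of "- (of_real s * z)" 1]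
    by (simp add: complex_nonneg_Reals_iff assms(4) ji N_def power2_eq_square algebra_simps flip: z_def)
  have "N = 0"
    \<comment> \<open>For nonzero \<open>N\<close> this \<open>s\<close> turns the bound into
      \<open>Re (A j j) + 1 \<le> Re (A j j)\<close>.\<close>
    using *[of "(Re (A j j) + 1) / (2 * N)"] by (cases "N = 0") auto
  then show ?thesis
    by (simp add: N_def z_def complex_eq_iff sum_power2_eq_zero_iff)
qed (use assms in simp)

text \<open>A vector on a subset of \<open>S\<close> extends by zero to all of \<open>S\<close>,
  which leaves a single index set to test.\<close>

lemma psd_on_finite_iff:
  assumes "finite S"
  shows "psd_on S A \<longleftrightarrow> (\<forall>v. (\<Sum>i\<in>S. \<Sum>j\<in>S. cnj (v i) * A i j * v j) \<in> \<real>\<^sub>\<ge>\<^sub>0)"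
proof
  assume *: "\<forall>v. (\<Sum>i\<in>S. \<Sum>j\<in>S. cnj (v i) * A i j * v j) \<in> \<real>\<^sub>\<ge>\<^sub>0"
  show "psd_on S A"
    unfolding psd_on_def
  proof safe
    fix F v
    assume F: "finite F" "F \<subseteq> S"
    have "(\<Sum>i\<in>F. \<Sum>j\<in>F. cnj (v i) * A i j * v j)
        = (\<Sum>i\<in>S. \<Sum>j\<in>S. cnj (if i \<in> F then v i else 0) * A i j * (if j \<in> F then v j else 0))"
      using assms F by (intro sum.mono_neutral_cong_left ballI) (auto intro!: sum.neutral)
    then show "(\<Sum>i\<in>F. \<Sum>j\<in>F. cnj (v i) * A i j * v j) \<in> \<real>\<^sub>\<ge>\<^sub>0"
      using *[rule_format, of "\<lambda>i. if i \<in> F then v i else 0"] by simp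
  qed
qed (use assms in \<open>auto simp: psd_on_def\<close>)

text \<open>A Gram representation turns the quadratic form into a sum over \<open>r\<close> of
  squared moduli of \<open>\<Sum>i\<in>F. cnj (v i) * U r i\<close>. Together with
  \<open>psd_on_gram\<close> it replaces spectral theory throughout.\<close>

lemma psd_onI_gram:
  assumes "\<And>i j. i \<in> S \<Longrightarrow> j \<in> S \<Longrightarrow> A i j = (\<Sum>r\<in>R. U r i * cnj (U r j))"
  shows "psd_on S A"
  unfolding psd_on_def
proof safe
  fix F v
  assume F: "finite F" "F \<subseteq> S"
  have "(\<Sum>i\<in>F. \<Sum>j\<in>F. cnj (v i) * A i j * v j)
      = (\<Sum>i\<in>F. \<Sum>j\<in>F. \<Sum>r\<in>R. (cnj (v i) * U r i) * cnj (cnj (v j) * U r j))"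
    using F by (intro sum.cong refl, subst assms)
      (auto simp: sum_distrib_left sum_distrib_right mult_ac intro!: sum.cong)
  also have "\<dots> = (\<Sum>r\<in>R. \<Sum>i\<in>F. \<Sum>j\<in>F. (cnj (v i) * U r i) * cnj (cnj (v j) * U r j))"
    by (rule sum_swap3)
  also have "\<dots> = (\<Sum>r\<in>R. (\<Sum>i\<in>F. cnj (v i) * U r i) * cnj (\<Sum>i\<in>F. cnj (v i) * U r i))"
    by (simp only: sum_product cnj_sum)
  also have "\<dots> \<in> \<real>\<^sub>\<ge>\<^sub>0"
    by (rule nonneg_Reals_sum) (simp only: complex_mult_cnj, simp add: complex_nonneg_Reals_iff)
  finally show "(\<Sum>i\<in>F. \<Sum>j\<in>F. cnj (v i) * A i j * v j) \<in> \<real>\<^sub>\<ge>\<^sub>0" .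
qed

text \<open>The elimination step of the Cholesky decomposition. By completing the square, the form
  of the complement at \<open>v\<close> is the form of \<open>A\<close> at an extension of
  \<open>v\<close> to \<open>x\<close>.\<close>

lemma psd_on_schur_complement:
  assumes psd: "psd_on (insert x S) A" and "finite S" "x \<notin> S" and nz: "A x x \<noteq> 0"
  shows "psd_on S (\<lambda>i j. A i j - A i x * A x j / A x x)"
  unfolding psd_on_finite_iff[OF \<open>finite S\<close>]
proof
  fix v
  define b where "b = (\<Sum>j\<in>S. A x j * v j)"
  have "cnj (A x x) = A x x"
    using psd_on_hermitian[OF psd, of x x] by simp
  moreover have herm: "A i x = cnj (A x i)" if "i \<in> S" for i
    using psd_on_hermitian[OF psd, of x i] that by simp
  ultimately have b': "(\<Sum>i\<in>S. cnj (v i) * A i x) = cnj b"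
    by (simp add: b_def mult.commute)
  \<comment> \<open>the value at \<open>x\<close> that minimises the quadratic form\<close>
  define w where "w = v(x := - b / A x x)"
  have wS: "w i = v i" if "i \<in> S" for i
    using that \<open>x \<notin> S\<close> by (auto simp: w_def)
  have "(\<Sum>i\<in>S. cnj (w i) * A i x * w x) = cnj b * w x"
    by (simp add: wS sum_distrib_right flip: b')
  moreover have "(\<Sum>j\<in>S. cnj (w x) * A x j * w j) = cnj (w x) * b"
    by (simp add: wS b_def sum_distrib_left mult.assoc)
  moreover have "(\<Sum>i\<in>S. \<Sum>j\<in>S. cnj (w i) * A i j * w j) = (\<Sum>i\<in>S. \<Sum>j\<in>S. cnj (v i) * A i j * v j)"
    by (simp add: wS)
  ultimately have "(\<Sum>i\<in>insert x S. \<Sum>j\<in>insert x S. cnj (w i) * A i j * w j)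
      = cnj (w x) * A x x * w x + cnj (w x) * b + cnj b * w x
        + (\<Sum>i\<in>S. \<Sum>j\<in>S. cnj (v i) * A i j * v j)"
    using \<open>finite S\<close> \<open>x \<notin> S\<close>
    by (simp add: sum.distrib)
  also have "\<dots> = (\<Sum>i\<in>S. \<Sum>j\<in>S. cnj (v i) * A i j * v j) - cnj b * b / A x x"
    using nz \<open>cnj (A x x) = A x x\<close> by (simp add: w_def field_simps)
  also have "cnj b * b / A x x = (\<Sum>i\<in>S. \<Sum>j\<in>S. cnj (v i) * (A i x * A x j / A x x) * v j)"
    unfolding b'[symmetric] unfolding b_def sum_product sum_divide_distrib
    by (intro sum.cong refl) simp
  finally have "(\<Sum>i\<in>S. \<Sum>j\<in>S. cnj (v i) * (A i j - A i x * A x j / A x x) * v j)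
      = (\<Sum>i\<in>insert x S. \<Sum>j\<in>insert x S. cnj (w i) * A i j * w j)"
    by (simp add: sum_subtractf algebra_simps)
  then show "(\<Sum>i\<in>S. \<Sum>j\<in>S. cnj (v i) * (A i j - A i x * A x j / A x x) * v j) \<in> \<real>\<^sub>\<ge>\<^sub>0"
    using psd \<open>finite S\<close> by (simp only: psd_on_finite_iff finite_insert)
qed

text \<open>Cholesky decomposition; \<open>r\<close> ranges over the pivots, and a zero pivot contributes \<open>x / 0 = 0\<close>.\<close>

lemma psd_on_gram:
  assumes "finite S" "psd_on S A"
  shows "\<exists>U. \<forall>i\<in>S. \<forall>j\<in>S. A i j = (\<Sum>r\<in>S. U r i * cnj (U r j))"
  using assms
proof (induction S arbitrary: A rule: finite_induct)
  case (insert x S)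
  note psd = insert.prems
  define A' where "A' = (\<lambda>i j. A i j - A i x * A x j / A x x)"
  have herm: "A i x = cnj (A x i)" if "i \<in> insert x S" for i
    using psd_on_hermitian[OF psd, of x i] that by simp
  have psd': "psd_on S A'"
  proof (cases "A x x = 0")
    case True
    then show ?thesis
      using psd_on_mono[OF psd, of S] by (simp add: A'_def subset_insertI)
  next
    case False
    then show ?thesis
      unfolding A'_def using psd_on_schur_complement[OF psd] insert.hyps by blast
  qed
  \<comment> \<open>Eliminating the pivot clears its row and column. For a zero pivot nothing is
    subtracted, but then \<open>psd_on_zero_diag\<close> already makes them zero.\<close>
  have A'x: "A' i x = 0" "A' x i = 0" if "i \<in> insert x S" for i
    using psd_on_zero_diag[OF psd, of x i] herm[OF that] that by (auto simp: A'_def)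
  obtain U where U: "\<And>i j. i \<in> S \<Longrightarrow> j \<in> S \<Longrightarrow> A' i j = (\<Sum>r\<in>S. U r i * cnj (U r j))"
    using insert.IH[OF psd'] by blast
  define d where "d = Re (A x x)"
  have d: "A x x = of_real d" "d \<ge> 0"
    using psd_on_diag[OF psd, of x] by (auto simp: d_def complex_nonneg_Reals_iff complex_eq_iff)
  \<comment> \<open>The vector for the new pivot is its column divided by the square root of the
    pivot. The induction hypothesis says nothing about \<open>U r x\<close>, so this value is
    replaced by 0, in accordance with the cleared row and column.\<close>
  define V where "V = (\<lambda>r i. if r = x then A i x / of_real (sqrt d) else if i = x then 0 else U r i)"
  have "A i j = (\<Sum>r\<in>insert x S. V r i * cnj (V r j))" if ij: "i \<in> insert x S" "j \<in> insert x S" for i j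
  proof -
    have "(\<Sum>r\<in>S. V r i * cnj (V r j)) = A' i j"
    proof (cases "i = x \<or> j = x")
      case True
      then have "(\<Sum>r\<in>S. V r i * cnj (V r j)) = 0"
        using insert.hyps by (intro sum.neutral) (auto simp: V_def)
      then show ?thesis
        using True A'x ij by auto
    next
      case False
      then have "A' i j = (\<Sum>r\<in>S. U r i * cnj (U r j))"
        using U ij by blast
      also have "\<dots> = (\<Sum>r\<in>S. V r i * cnj (V r j))"
        using False insert.hyps by (intro sum.cong) (auto simp: V_def)
      finally show ?thesis by simp
    qed
    moreover have "V x i * cnj (V x j) = A i x * A x j / A x x"
      using herm[OF ij(2)] d
      by (simp add: V_def flip: of_real_mult)
    ultimately show ?thesis
      using insert.hyps by (simp add: A'_def)
  qed
  then show ?case by blast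
qed simp

text \<open>Gram vectors pull back along any \<open>g\<close>, injective or not.\<close>

lemma psd_on_reindex:
  assumes "finite T" "psd_on T A" "g ` S \<subseteq> T"
  shows "psd_on S (\<lambda>i j. A (g i) (g j))"
proof -
  from psd_on_gram[OF assms(1,2)] obtain U
    where "\<And>i j. i \<in> T \<Longrightarrow> j \<in> T \<Longrightarrow> A i j = (\<Sum>r\<in>T. U r i * cnj (U r j))"
    by blast
  then show ?thesis
    using assms(3) by (intro psd_onI_gram[where U = "\<lambda>r i. U r (g i)" and R = T]) auto
qed

section \<open>The cone of positive semidefinite matrices\<close>

lemma psd_zero: "psd 0"
  by (simp add: psd_def psd_on_def)

lemma psd_add:
  assumes "psd A" "psd B"
  shows "psd (A + B)"
  unfolding psd_def psd_on_def
proof safe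
  fix F and v :: "'a \<Rightarrow> complex"
  assume "finite (F :: 'a set)"
  have "(\<Sum>i\<in>F. \<Sum>j\<in>F. cnj (v i) * (A + B) $ i $ j * v j)
      = (\<Sum>i\<in>F. \<Sum>j\<in>F. cnj (v i) * A $ i $ j * v j) + (\<Sum>i\<in>F. \<Sum>j\<in>F. cnj (v i) * B $ i $ j * v j)"
    by (simp add: ring_distribs sum.distrib)
  also have "\<dots> \<in> \<real>\<^sub>\<ge>\<^sub>0"
    using assms \<open>finite F\<close> unfolding psd_def psd_on_def by (intro nonneg_Reals_add_I) auto
  finally show "(\<Sum>i\<in>F. \<Sum>j\<in>F. cnj (v i) * (A + B) $ i $ j * v j) \<in> \<real>\<^sub>\<ge>\<^sub>0" .
qed

lemma psd_sum: "(\<And>l. l \<in> L \<Longrightarrow> psd (A l)) \<Longrightarrow> psd (sum A L)"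
  by (induction L rule: infinite_finite_induct) (auto simp: psd_zero psd_add)

lemma psd_scaleR:
  assumes "psd A" "0 \<le> t"
  shows "psd (t *\<^sub>R A)"
  unfolding psd_def psd_on_def
proof safe
  fix F and v :: "'a \<Rightarrow> complex"
  assume "finite (F :: 'a set)"
  have "(\<Sum>i\<in>F. \<Sum>j\<in>F. cnj (v i) * (t *\<^sub>R A) $ i $ j * v j)
      = of_real t * (\<Sum>i\<in>F. \<Sum>j\<in>F. cnj (v i) * A $ i $ j * v j)"
    unfolding sum_distrib_left by (intro sum.cong refl) (simp add: scaleR_conv_of_real[where 'a = complex])
  also have "\<dots> \<in> \<real>\<^sub>\<ge>\<^sub>0"
    using assms \<open>finite F\<close> unfolding psd_def psd_on_def by (intro nonneg_Reals_mult_I) auto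
  finally show "(\<Sum>i\<in>F. \<Sum>j\<in>F. cnj (v i) * (t *\<^sub>R A) $ i $ j * v j) \<in> \<real>\<^sub>\<ge>\<^sub>0" .
qed

lemma psd_mat_1: "psd (mat 1)"
  unfolding psd_def
  by (rule psd_onI_gram[where R = UNIV and U = "\<lambda>r i. if r = i then 1 else 0"])
    (simp add: mat_def if_distrib[of cnj] if_distrib[of "\<lambda>x. _ * x"] cong: if_cong)


section \<open>The Choi correspondence\<close>

text \<open>The inverse Choi correspondence, in exactly the form in which \<open>W\<close> enters
  the program, but without the factor \<open>d_B\<close>.\<close>

definition choi_map :: "complex ^ ('b::finite \<times> 'c::finite) ^ ('b \<times> 'c) \<Rightarrow> complex ^ 'b ^ 'b \<Rightarrow> complex ^ 'c ^ 'c"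
  where "choi_map W X = trace_fst (W ** mat_tensor (transpose X) (mat 1))"

text \<open>The transpose cancels the index swap of the matrix product, so \<open>X\<close> is
  contracted with Bob's input indices in their original order. Linearity in \<open>W\<close> and in
  \<open>X\<close> can be read off.\<close>

lemma choi_map_nth: "choi_map W X $ k $ l = (\<Sum>i\<in>UNIV. \<Sum>j\<in>UNIV. W $ (i, k) $ (j, l) * X $ i $ j)"
proof -
  have "choi_map W X $ k $ l
      = (\<Sum>i\<in>UNIV. \<Sum>q\<in>UNIV \<times> UNIV. W $ (i, k) $ q * (X $ i $ fst q * (if snd q = l then 1 else 0)))"
    by (simp add: choi_map_def trace_fst_def matrix_matrix_mult_def mat_tensor_def transpose_def mat_def)
  also have "\<dots> = (\<Sum>i\<in>UNIV. \<Sum>j\<in>UNIV. W $ (i, k) $ (j, l) * X $ i $ j)"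
    unfolding sum.cartesian_product'
    by (simp add: if_distrib[of "\<lambda>x. _ * x"] cong: if_cong)
  finally show ?thesis .
qed

lemma cscale_nth [simp]: "cscale c A $ i $ j = c * A $ i $ j"
  by (simp add: cscale_def map_matrix_def)

lemma cscale_of_real: "cscale (of_real t) A = t *\<^sub>R A"
  by (simp add: vec_eq_iff scaleR_conv_of_real[where 'a = complex])

lemma trace_snd_scaleR: "trace_snd (t *\<^sub>R W) = t *\<^sub>R trace_snd W"
  by (simp add: trace_snd_def vec_eq_iff scaleR_sum_right)

lemma trace_snd_sum: "trace_snd (sum W L) = (\<Sum>l\<in>L. trace_snd (W l))"
  by (induction L rule: infinite_finite_induct) (auto simp: trace_snd_def vec_eq_iff sum.distrib)

lemma choi_map_scaleR: "choi_map (t *\<^sub>R W) X = t *\<^sub>R choi_map W X"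
  by (simp add: choi_map_nth vec_eq_iff scaleR_sum_right)

lemma choi_map_sum: "choi_map (sum W L) X = (\<Sum>l\<in>L. choi_map (W l) X)"
  by (induction L rule: infinite_finite_induct)
    (auto simp: choi_map_nth vec_eq_iff ring_distribs sum.distrib)

lemma clinear_map_choi_map: "clinear_map (choi_map W)"
  by (simp add: clinear_map_def choi_map_nth vec_eq_iff ring_distribs sum.distrib
      sum_distrib_left mult_ac)

text \<open>Substituting Gram representations of \<open>X\<close> and of \<open>W\<close> makes
  every summand of the output a product of a factor in \<open>(m, i, k)\<close> and a conjugated
  factor in \<open>(m', j, l)\<close>. Summing over \<open>i\<close> and \<open>j\<close> then
  yields a Gram representation of the output.\<close>

lemma completely_positive_choi_map:
  fixes W :: "complex ^ ('b::finite \<times> 'c::finite) ^ ('b \<times> 'c)"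
  assumes "psd W"
  shows "completely_positive (choi_map W)"
  unfolding completely_positive_def
proof (intro conjI allI impI clinear_map_choi_map)
  fix n and X :: "(nat \<times> 'b) kernel"
  define T :: "(nat \<times> 'b) set" where "T = {..<n} \<times> UNIV"
  assume "psd_on ({..<n} \<times> UNIV) X"
  moreover have "finite T"
    by (simp add: T_def)
  ultimately obtain U where U: "\<And>p q. p \<in> T \<Longrightarrow> q \<in> T \<Longrightarrow> X p q = (\<Sum>r\<in>T. U r p * cnj (U r q))"
    using psd_on_gram[of T X] unfolding T_def by blast
  obtain V :: "'b \<times> 'c \<Rightarrow> 'b \<times> 'c \<Rightarrow> complex"
    where V: "W $ p $ q = (\<Sum>s\<in>UNIV. V s p * cnj (V s q))" for p q
    using assms psd_on_gram[of UNIV "\<lambda>p q. W $ p $ q"] unfolding psd_def by fastforce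
  \<comment> \<open>Each \<open>V s\<close>, read as a matrix from Bob's input to his output space,
    is a Kraus operator of the map; \<open>Z\<close> collects the images of the vectors
    \<open>U r\<close> under these operators.\<close>
  define Z where "Z = (\<lambda>(r, s) (m, k). \<Sum>i\<in>UNIV. V s (i, k) * U r (m, i))"
  have "ampliation (choi_map W) X (m, k) (m', l)
      = (\<Sum>t\<in>T \<times> UNIV. Z t (m, k) * cnj (Z t (m', l)))" if "m < n" "m' < n" for m m' k l
  proof -
    have "ampliation (choi_map W) X (m, k) (m', l)
      = (\<Sum>i\<in>UNIV. \<Sum>j\<in>UNIV. \<Sum>t\<in>T \<times> UNIV. 
          (V (snd t) (i, k) * U (fst t) (m, i)) * cnj (V (snd t) (j, l) * U (fst t) (m', j)))"
    proof -
      have "W $ (i, k) $ (j, l) * X (m, i) (m', j) = (\<Sum>t\<in>T \<times> UNIV.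
          (V (snd t) (i, k) * U (fst t) (m, i)) * cnj (V (snd t) (j, l) * U (fst t) (m', j)))" for i j
      proof -
        have "W $ (i, k) $ (j, l) * X (m, i) (m', j)
          = (\<Sum>r\<in>T. U r (m, i) * cnj (U r (m', j))) * (\<Sum>s\<in>UNIV. V s (i, k) * cnj (V s (j, l)))"
          using that by (subst U) (auto simp: T_def V)
        then show ?thesis
          unfolding sum_product sum.cartesian_product case_prod_unfold
          by (elim ssubst, intro sum.cong refl) simp
      qed
      then show ?thesis
        by (simp add: ampliation_def choi_map_nth)
    qed
    also have "\<dots> = (\<Sum>t\<in>T \<times> UNIV. \<Sum>i\<in>UNIV. \<Sum>j\<in>UNIV.
          (V (snd t) (i, k) * U (fst t) (m, i)) * cnj (V (snd t) (j, l) * U (fst t) (m', j)))"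
      by (rule sum_swap3)
    also have "\<dots> = (\<Sum>t\<in>T \<times> UNIV. Z t (m, k) * cnj (Z t (m', l)))"
      by (simp only: Z_def case_prod_unfold fst_conv snd_conv sum_product cnj_sum)
    finally show ?thesis .
  qed
  then show "psd_on ({..<n} \<times> UNIV) (ampliation (choi_map W) X)"
    by (intro psd_onI_gram[where R = "T \<times> UNIV" and U = Z]) auto
qed

text \<open>Summing over the output index first pairs \<open>A\<close> with the marginal
  \<open>trace_snd W\<close>; an identity marginal therefore means trace preservation.\<close>

lemma cptp_choi_map:
  assumes "psd W" "trace_snd W = mat 1"
  shows "cptp (choi_map W)"
proof -
  have "trace (choi_map W A) = trace A" for A
  proof -
    have "trace (choi_map W A) = (\<Sum>k\<in>UNIV. \<Sum>i\<in>UNIV. \<Sum>j\<in>UNIV. W $ (i, k) $ (j, k) * A $ i $ j)"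
      by (simp add: trace_def choi_map_nth)
    also have "\<dots> = (\<Sum>i\<in>UNIV. \<Sum>j\<in>UNIV. \<Sum>k\<in>UNIV. W $ (i, k) $ (j, k) * A $ i $ j)"
      by (rule sum_swap3[symmetric])
    also have "\<dots> = (\<Sum>i\<in>UNIV. \<Sum>j\<in>UNIV. trace_snd W $ i $ j * A $ i $ j)"
      by (simp add: trace_snd_def sum_distrib_right)
    also have "\<dots> = trace A"
      by (simp add: assms(2) mat_def trace_def if_distrib[of "\<lambda>x. x * _"] cong: if_cong)
    finally show ?thesis .
  qed
  then show ?thesis
    by (simp add: cptp_def completely_positive_choi_map assms(1))
qed

section \<open>Choi matrices of channels\<close>

definition matrix_unit :: "'b \<Rightarrow> 'b \<Rightarrow> complex ^ 'b ^ 'b" where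
  "matrix_unit i j = (\<chi> a b. if a = i \<and> b = j then 1 else 0)"

text \<open>Unnormalised: the marginal of a channel is the identity, and the factor
  \<open>1 / d_B\<close> of the program is supplied when \<open>W\<close> is built.\<close>

definition choi_matrix :: "(complex ^ 'b ^ 'b \<Rightarrow> complex ^ 'c ^ 'c) \<Rightarrow> complex ^ ('b::finite \<times> 'c::finite) ^ ('b \<times> 'c)"
  where "choi_matrix E = (\<chi> p q. E (matrix_unit (fst p) (fst q)) $ snd p $ snd q)"

lemma clinear_map_sum:
  assumes "clinear_map E"
  shows "E (sum A L) = (\<Sum>l\<in>L. E (A l))"
proof -
  have "E 0 + E 0 = E 0"
    using assms unfolding clinear_map_def by (metis add_0)
  then have "E 0 = 0" by simp
  then show ?thesis
    using assms by (induction L rule: infinite_finite_induct) (auto simp: clinear_map_def)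
qed

text \<open>Expanding \<open>X\<close> in matrix units and using complex linearity reduces
  \<open>E X\<close> to the values of \<open>E\<close> recorded in the Choi matrix.\<close>

lemma choi_map_choi_matrix:
  fixes E :: "complex ^ 'b ^ 'b \<Rightarrow> complex ^ 'c ^ 'c"
  assumes "clinear_map E"
  shows "choi_map (choi_matrix E) X = E X"
proof -
  have "X = (\<Sum>i\<in>UNIV. \<Sum>j\<in>UNIV. cscale (X $ i $ j) (matrix_unit i j))"
  proof -
    have "(\<Sum>j\<in>UNIV. X $ i $ j * (if a = i \<and> b = j then 1 else 0)) = (if a = i then X $ i $ b else 0)"
      for a i b
      by (simp add: if_distrib[of "\<lambda>x. _ * x"] cong: if_cong)
    then show ?thesis
      by (simp add: vec_eq_iff sum_component matrix_unit_def)
  qed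
  then have "E X = E (\<Sum>i\<in>UNIV. \<Sum>j\<in>UNIV. cscale (X $ i $ j) (matrix_unit i j))"
    by (rule arg_cong)
  also have "\<dots> = (\<Sum>i\<in>UNIV. \<Sum>j\<in>UNIV. cscale (X $ i $ j) (E (matrix_unit i j)))"
    using assms by (simp add: clinear_map_sum[OF assms] clinear_map_def)
  finally have "E X = (\<Sum>i\<in>UNIV. \<Sum>j\<in>UNIV. cscale (X $ i $ j) (E (matrix_unit i j)))" .
  then show ?thesis
    by (simp add: vec_eq_iff choi_map_nth choi_matrix_def sum_component mult.commute)
qed

text \<open>The entries of the marginal are the traces of the images of matrix units, and
  \<open>E\<close> preserves traces.\<close>

lemma trace_snd_choi_matrix:
  assumes "cptp E"
  shows "trace_snd (choi_matrix E) = mat 1"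
proof -
  have "trace_snd (choi_matrix E) $ i $ j = trace (E (matrix_unit i j))" for i j
    by (simp add: trace_snd_def choi_matrix_def trace_def)
  also have "\<dots> i j = (if i = j then 1 else 0)" for i j
    using assms by (cases "i = j") (auto simp: cptp_def trace_def matrix_unit_def intro!: sum.neutral)
  finally show ?thesis
    by (simp add: vec_eq_iff mat_def)
qed

text \<open>The Choi matrix is the image of the unnormalised maximally entangled state under the
  ampliation of \<open>E\<close>. Ancilla indices are natural numbers, so \<open>h\<close> numbers
  the basis of Bob's space.\<close>

lemma psd_choi_matrix:
  fixes E :: "complex ^ 'b ^ 'b \<Rightarrow> complex ^ 'c ^ 'c"
  assumes "completely_positive E"
  shows "psd (choi_matrix E)"
proof -
  define n where "n = CARD('b)"
  obtain h where h: "bij_betw h (UNIV :: 'b set) {..<n}"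
    unfolding n_def using ex_bij_betw_finite_nat[of "UNIV :: 'b set"] by (auto simp: lessThan_atLeast0)
  then have inj: "h i = h j \<longleftrightarrow> i = j" for i j
    by (auto simp: bij_betw_def inj_on_def)
  have hn: "h i < n" for i
    using h by (auto simp: bij_betw_def)
  \<comment> \<open>The rank-one kernel of the vector that is 1 at the pairs \<open>(h i, i)\<close>
    and 0 elsewhere.\<close>
  define X :: "(nat \<times> 'b) kernel"
    where "X = (\<lambda>p q. (if fst p = h (snd p) then 1 else 0) * (if fst q = h (snd q) then 1 else 0))"
  have "psd_on ({..<n} \<times> UNIV) X"
    by (rule psd_onI_gram[where R = "{()}" and U = "\<lambda>_ p. if fst p = h (snd p) then 1 else 0"])
      (simp add: X_def)
  then have "psd_on ({..<n} \<times> UNIV) (ampliation E X)"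
    using assms by (simp add: completely_positive_def)
  then have "psd_on UNIV (\<lambda>p q. ampliation E X (h (fst p), snd p) (h (fst q), snd q))"
    by (rule psd_on_reindex[rotated]) (auto simp: hn)
  moreover have "(\<chi> a b. X (h i, a) (h j, b)) = matrix_unit i j" for i j
    by (auto simp: X_def matrix_unit_def vec_eq_iff inj)
  then have "ampliation E X (h (fst p), snd p) (h (fst q), snd q) = choi_matrix E $ p $ q" for p q
    by (simp add: ampliation_def choi_matrix_def)
  ultimately show ?thesis
    by (simp add: psd_def)
qed

section \<open>From the marginal constraint to weights and channels\<close>

text \<open>Nonnegative diagonal entries with vanishing sums are all zero, and a zero diagonal entry
  clears its row. This covers the strategies of weight zero.\<close>

lemma psd_eq_0:
  assumes "psd W" "trace_snd W = 0"
  shows "W = 0"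
proof -
  have diag: "W $ p $ p \<in> \<real>\<^sub>\<ge>\<^sub>0" for p
    using assms(1) psd_on_diag[of UNIV "\<lambda>p q. W $ p $ q" p] by (simp add: psd_def)
  have "W $ (i, k) $ (i, k) = 0" for i k
  proof -
    have "(\<Sum>k\<in>UNIV. W $ (i, k) $ (i, k)) = 0"
      using assms(2) by (simp add: trace_snd_def vec_eq_iff)
    then have "(\<Sum>k\<in>UNIV. Re (W $ (i, k) $ (i, k))) = 0"
      by (metis Re_sum zero_complex.simps(1))
    then have "Re (W $ (i, k) $ (i, k)) = 0"
      by (subst (asm) sum_nonneg_eq_0_iff) (use diag in \<open>auto simp: complex_nonneg_Reals_iff\<close>)
    with diag[of "(i, k)"] show ?thesis
      by (simp add: complex_nonneg_Reals_iff complex_eq_iff)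
  qed
  then have "W $ p $ q = 0" for p q
    using assms(1) psd_on_zero_diag[of UNIV "\<lambda>p q. W $ p $ q" p q] by (cases p) (simp add: psd_def)
  then show ?thesis
    by (simp add: vec_eq_iff)
qed

text \<open>The program allows a complex factor \<open>t\<close>. Since \<open>t / d_B\<close> is a
  diagonal entry of the marginal of a positive matrix, \<open>t\<close> is real and nonnegative and
  can serve as a probability weight.\<close>

lemma psd_proportional_trace_snd:
  fixes W :: "complex ^ ('b::finite \<times> 'c::finite) ^ ('b \<times> 'c)"
  assumes "psd W" "trace_snd W = cscale t (cscale (1 / of_nat CARD('b)) (mat 1))"
  obtains s where "s \<ge> 0" "trace_snd W = (s / CARD('b)) *\<^sub>R mat 1"
proof -
  have "trace_snd W $ i $ i \<in> \<real>\<^sub>\<ge>\<^sub>0" for i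
    using assms(1) psd_on_diag[of UNIV "\<lambda>p q. W $ p $ q"]
    by (auto simp: trace_snd_def psd_def intro!: nonneg_Reals_sum)
  then have "t / of_nat CARD('b) \<in> \<real>\<^sub>\<ge>\<^sub>0"
    using assms(2) by (simp add: mat_def)
  then have "t / of_nat CARD('b) * of_nat CARD('b) \<in> \<real>\<^sub>\<ge>\<^sub>0"
    by (intro nonneg_Reals_mult_I) auto
  then have "t \<in> \<real>\<^sub>\<ge>\<^sub>0"
    by simp
  then obtain s where s: "t = of_real s" "s \<ge> 0"
    by (auto elim: nonneg_Reals_cases)
  have "trace_snd W = cscale (of_real (s / CARD('b))) (mat 1)"
    by (simp add: assms(2) s vec_eq_iff)
  then show ?thesis
    using s that by (simp only: cscale_of_real)
qed

text \<open>If \<open>s = 0\<close>, then \<open>W = 0\<close> and any channel serves.\<close>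

lemma choi_map_normalized:
  fixes W :: "complex ^ ('b::finite \<times> 'c::finite) ^ ('b \<times> 'c)"
  assumes "psd W" "s \<ge> 0" "trace_snd W = (s / CARD('b)) *\<^sub>R mat 1"
  obtains E where "cptp E" "\<And>X. s *\<^sub>R E X = real CARD('b) *\<^sub>R choi_map W X"
proof (cases "s = 0")
  case True
  \<comment> \<open>The Choi matrix of the completely depolarising channel.\<close>
  define V :: "complex ^ ('b \<times> 'c) ^ ('b \<times> 'c)" where "V = (1 / CARD('c)) *\<^sub>R mat 1"
  have "trace_snd (mat 1 :: complex ^ ('b \<times> 'c) ^ ('b \<times> 'c)) = real CARD('c) *\<^sub>R mat 1"
    by (simp add: trace_snd_def mat_def vec_eq_iff scaleR_conv_of_real[where 'a = complex])
  then have "cptp (choi_map V)"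
    by (intro cptp_choi_map) (simp_all add: V_def psd_scaleR psd_mat_1 trace_snd_scaleR)
  moreover have "W = 0"
    using assms True by (intro psd_eq_0) auto
  then have "choi_map W X = 0" for X
    by (simp add: choi_map_nth vec_eq_iff)
  ultimately show ?thesis
    using True that by simp
next
  case False
  define V where "V = (CARD('b) / s) *\<^sub>R W"
  have "cptp (choi_map V)"
    using assms False by (intro cptp_choi_map) (simp_all add: V_def psd_scaleR trace_snd_scaleR)
  moreover have "s *\<^sub>R choi_map V X = real CARD('b) *\<^sub>R choi_map W X" for X
    using False by (simp add: V_def choi_map_scaleR)
  ultimately show ?thesis
    using that by blast
qed


section \<open>Deterministic decomposition of local classical boxes\<close>

text \<open>If the values \<open>\<phi> x\<close> are drawn independently with laws
  \<open>K x\<close>, then \<open>\<phi> x0\<close> has law \<open>K x0\<close>.\<close>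

lemma sum_prod_marginal:
  fixes K :: "'x::finite \<Rightarrow> 'y::finite \<Rightarrow> real"
  assumes "\<And>x. (\<Sum>y\<in>UNIV. K x y) = 1"
  shows "(\<Sum>\<phi>\<in>UNIV. (\<Prod>x\<in>UNIV. K x (\<phi> x)) * G (\<phi> x0)) = (\<Sum>y\<in>UNIV. K x0 y * G y)"
proof -
  \<comment> \<open>Absorbing \<open>G\<close> into the factor at \<open>x0\<close> leaves a pure
    product, so that the sum over functions factorises by distributivity. The factors at other
    points are 1.\<close>
  have "(\<Sum>\<phi>\<in>UNIV. (\<Prod>x\<in>UNIV. K x (\<phi> x)) * G (\<phi> x0))
      = (\<Sum>\<phi>\<in>UNIV. \<Prod>x\<in>UNIV. K x (\<phi> x) * (if x = x0 then G (\<phi> x) else 1))"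
    by (simp add: prod.distrib cong: if_cong)
  also have "\<dots> = (\<Prod>x\<in>UNIV. \<Sum>y\<in>UNIV. K x y * (if x = x0 then G y else 1))"
    using prod_sum_PiE[of UNIV "\<lambda>_. UNIV" "\<lambda>x y. K x y * (if x = x0 then G y else 1)"]
    by (simp add: PiE_UNIV_domain)
  also have "\<dots> = (\<Prod>x\<in>UNIV. if x = x0 then \<Sum>y\<in>UNIV. K x0 y * G y else 1)"
    by (rule prod.cong) (auto simp: assms)
  also have "\<dots> = (\<Sum>y\<in>UNIV. K x0 y * G y)"
    by simp
  finally show ?thesis .
qed

text \<open>The box prescribes only the joint law of the setting for one \<open>x'\<close> and the
  response to one \<open>a\<close>. Correlations between different \<open>x'\<close>, or between
  responses to different \<open>a\<close>, are free, so products may be chosen.\<close>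

lemma local_box_deterministic_decomposition:
  fixes q :: "'x'::finite \<Rightarrow> nat \<times> 'x::finite \<Rightarrow> real" and r :: "'a::finite \<Rightarrow> nat \<Rightarrow> 'a'::finite \<Rightarrow> real"
  assumes q: "\<And>x'. prob_dist_on (C \<times> UNIV) (q x')"
    and r: "\<And>a c. c \<in> C \<Longrightarrow> prob_dist_on UNIV (r a c)"
  obtains \<mu> :: "('a, 'x, 'a', 'x') strategy \<Rightarrow> real"
  where "\<And>s. 0 \<le> \<mu> s" "sum \<mu> UNIV = 1"
    "\<And>x' x a a'. (\<Sum>c\<in>C. q x' (c, x) * r a c a')
       = (\<Sum>s\<in>UNIV. \<mu> s * (D_outcome s a' a x' * D_setting s x x'))"
proof -
  \<comment> \<open>\<open>K x'\<close> is the joint law of the response function and the setting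
    for input \<open>x'\<close>, with the message \<open>c\<close> summed out.\<close>
  define K where "K = (\<lambda>x' (h, x). \<Sum>c\<in>C. q x' (c, x) * (\<Prod>a\<in>UNIV. r a c (h a)))"
  define \<mu> :: "('a, 'x, 'a', 'x') strategy \<Rightarrow> real"
    where "\<mu> = (\<lambda>s. \<Prod>x'\<in>UNIV. K x' (\<lambda>a. fst s (a, x'), snd s x'))"
  have K_nonneg: "0 \<le> K x' y" for x' y
    using q r unfolding K_def prob_dist_on_def
    by (cases y) (auto intro!: sum_nonneg mult_nonneg_nonneg prod_nonneg)
  have marg: "(\<Sum>h\<in>UNIV. (\<Prod>a\<in>UNIV. r a c (h a)) * G (h a0)) = (\<Sum>y\<in>UNIV. r a0 c y * G y)"
    if "c \<in> C" for c a0 and G :: "'a' \<Rightarrow> real"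
    using r[OF that] by (intro sum_prod_marginal) (simp add: prob_dist_on_def)
  \<comment> \<open>Given \<open>c\<close>, only the response to \<open>a\<close> is tested; the
    others sum to 1.\<close>
  have K_marg: "(\<Sum>y\<in>UNIV. K x' y * (G (fst y a) * H (snd y)))
      = (\<Sum>x\<in>UNIV. \<Sum>c\<in>C. q x' (c, x) * (\<Sum>y\<in>UNIV. r a c y * G y) * H x)"
    for x' a and G :: "'a' \<Rightarrow> real" and H :: "'x \<Rightarrow> real"
  proof -
    have "(\<Sum>y\<in>UNIV. K x' y * (G (fst y a) * H (snd y)))
      = (\<Sum>h\<in>UNIV. \<Sum>x\<in>UNIV. \<Sum>c\<in>C. q x' (c, x) * ((\<Prod>a\<in>UNIV. r a c (h a)) * G (h a)) * H x)"
      unfolding UNIV_Times_UNIV[symmetric] sum.cartesian_product'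
      by (simp add: K_def sum_distrib_left sum_distrib_right mult_ac)
    also have "\<dots> = (\<Sum>x\<in>UNIV. \<Sum>c\<in>C. \<Sum>h\<in>UNIV. q x' (c, x) * ((\<Prod>a\<in>UNIV. r a c (h a)) * G (h a)) * H x)"
      by (rule sum_swap3[symmetric])
    also have "\<dots> = (\<Sum>x\<in>UNIV. \<Sum>c\<in>C. q x' (c, x) * (\<Sum>y\<in>UNIV. r a c y * G y) * H x)"
      by (intro sum.cong refl) (simp add: marg flip: sum_distrib_left sum_distrib_right)
    finally show ?thesis .
  qed
  have K_sum: "(\<Sum>y\<in>UNIV. K x' y) = 1" for x'
  proof -
    \<comment> \<open>Constant test functions give the total mass; \<open>undefined\<close> stands
      for an arbitrary outcome \<open>a\<close>.\<close>
    have "(\<Sum>y\<in>UNIV. K x' y) = (\<Sum>x\<in>UNIV. \<Sum>c\<in>C. q x' (c, x) * (\<Sum>y\<in>UNIV. r undefined c y))"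
      using K_marg[of x' "\<lambda>_. 1" undefined "\<lambda>_. 1"] by simp
    also have "\<dots> = (\<Sum>x\<in>UNIV. \<Sum>c\<in>C. q x' (c, x))"
      using r by (intro sum.cong refl) (simp add: prob_dist_on_def)
    also have "\<dots> = 1"
      using q[of x'] by (subst sum.swap) (simp add: prob_dist_on_def sum.cartesian_product')
    finally show ?thesis .
  qed
  have \<mu>_marg: "(\<Sum>s\<in>UNIV. \<mu> s * G (\<lambda>a. fst s (a, x'), snd s x')) = (\<Sum>y\<in>UNIV. K x' y * G y)"
    for x' G
  proof -
    \<comment> \<open>Currying identifies a strategy with a family \<open>\<phi>\<close> giving each
      \<open>x'\<close> a response function and a setting. Under this bijection \<open>\<mu>\<close>
      is the product of the laws \<open>K x'\<close>.\<close>
    have "(\<Sum>s\<in>UNIV. \<mu> s * G (\<lambda>a. fst s (a, x'), snd s x'))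
      = (\<Sum>\<phi>\<in>UNIV. (\<Prod>x'\<in>UNIV. K x' (\<phi> x')) * G (\<phi> x'))"
      by (rule sum.reindex_bij_witness[of _
            "\<lambda>\<phi>. (\<lambda>(a, x'). fst (\<phi> x') a, \<lambda>x'. snd (\<phi> x'))"
            "\<lambda>s x'. (\<lambda>a. fst s (a, x'), snd s x')"]) (auto simp: \<mu>_def)
    also have "\<dots> = (\<Sum>y\<in>UNIV. K x' y * G y)"
      by (rule sum_prod_marginal) (rule K_sum)
    finally show ?thesis .
  qed
  show ?thesis
  proof
    show "0 \<le> \<mu> s" for s
      by (simp add: \<mu>_def K_nonneg prod_nonneg)
    show "sum \<mu> UNIV = 1"
      using \<mu>_marg[of "\<lambda>_. 1" undefined] by (simp add: K_sum)
    fix x' x a a'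
    have "(\<Sum>s\<in>UNIV. \<mu> s * (D_outcome s a' a x' * D_setting s x x'))
       = (\<Sum>y\<in>UNIV. K x' y * ((if a' = fst y a then 1 else 0) * (if x = snd y then 1 else 0)))"
      using \<mu>_marg[of "\<lambda>y. (if a' = fst y a then 1 else 0) * (if x = snd y then 1 else 0)" x']
      by (simp add: D_outcome_def D_setting_def)
    also have "\<dots> = (\<Sum>z\<in>UNIV. \<Sum>c\<in>C. q x' (c, z) * r a c a' * (if x = z then 1 else 0))"
      using K_marg[of x' "\<lambda>y. if a' = y then 1 else 0" a "\<lambda>z. if x = z then 1 else 0"]
      by (simp add: if_distrib[of "\<lambda>x. _ * x"] cong: if_cong)
    also have "\<dots> = (\<Sum>z\<in>UNIV. if x = z then \<Sum>c\<in>C. q x' (c, z) * r a c a' else 0)"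
      by (intro sum.cong refl) simp
    also have "\<dots> = (\<Sum>c\<in>C. q x' (c, x) * r a c a')"
      by simp
    finally show "(\<Sum>c\<in>C. q x' (c, x) * r a c a')
       = (\<Sum>s\<in>UNIV. \<mu> s * (D_outcome s a' a x' * D_setting s x x'))" by simp
  qed
qed

text \<open>A decomposition is chosen separately for each value \<open>l\<close> of the shared
  randomness, within \<open>L\<close>, where the boxes are known to be normalised.\<close>

lemma local_boxes_deterministic_decomposition:
  fixes q :: "'x'::finite \<Rightarrow> 'l \<Rightarrow> nat \<times> 'x::finite \<Rightarrow> real" and r :: "'a::finite \<Rightarrow> nat \<Rightarrow> 'a'::finite \<Rightarrow> real"
  assumes q: "\<And>x' l. l \<in> L \<Longrightarrow> prob_dist_on (C \<times> UNIV) (q x' l)"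
    and r: "\<And>a c. c \<in> C \<Longrightarrow> prob_dist_on UNIV (r a c)"
  obtains \<mu> :: "'l \<Rightarrow> ('a, 'x, 'a', 'x') strategy \<Rightarrow> real"
  where "\<And>l s. l \<in> L \<Longrightarrow> 0 \<le> \<mu> l s" "\<And>l. l \<in> L \<Longrightarrow> sum (\<mu> l) UNIV = 1"
    "\<And>l x' x a a'. l \<in> L \<Longrightarrow> (\<Sum>c\<in>C. q x' l (c, x) * r a c a')
       = (\<Sum>s\<in>UNIV. \<mu> l s * (D_outcome s a' a x' * D_setting s x x'))"
proof -
  have "\<exists>\<mu> :: 'l \<Rightarrow> ('a, 'x, 'a', 'x') strategy \<Rightarrow> real. \<forall>l\<in>L. (\<forall>s. 0 \<le> \<mu> l s) \<and> sum (\<mu> l) UNIV = 1 \<and>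
      (\<forall>x' x a a'. (\<Sum>c\<in>C. q x' l (c, x) * r a c a')
         = (\<Sum>s\<in>UNIV. \<mu> l s * (D_outcome s a' a x' * D_setting s x x')))"
  proof (rule bchoice, rule ballI)
    fix l assume "l \<in> L"
    obtain \<mu> :: "('a, 'x, 'a', 'x') strategy \<Rightarrow> real" where
      "\<And>s. 0 \<le> \<mu> s" "sum \<mu> UNIV = 1"
      "\<And>x' x a a'. (\<Sum>c\<in>C. q x' l (c, x) * r a c a')
         = (\<Sum>s\<in>UNIV. \<mu> s * (D_outcome s a' a x' * D_setting s x x'))"
      using local_box_deterministic_decomposition[of C "\<lambda>x'. q x' l" r, OF q[OF \<open>l \<in> L\<close>] r] by blast
    then show "\<exists>\<mu> :: ('a, 'x, 'a', 'x') strategy \<Rightarrow> real. (\<forall>s. 0 \<le> \<mu> s) \<and> sum \<mu> UNIV = 1 \<and>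
      (\<forall>x' x a a'. (\<Sum>c\<in>C. q x' l (c, x) * r a c a')
         = (\<Sum>s\<in>UNIV. \<mu> s * (D_outcome s a' a x' * D_setting s x x')))"
      by blast
  qed
  then show ?thesis
    using that by blast
qed


section \<open>Conversion and the semidefinite program\<close>

text \<open>Serves both for message pairs \<open>(c1, c2)\<close>, which it collapses into local
  boxes, and for strategy pairs, into which those boxes are expanded again.\<close>

lemma sum_scaleR_product:
  fixes F :: "'z \<Rightarrow> 'v::real_vector"
  shows "(\<Sum>c1\<in>C1. \<Sum>c2\<in>C2. \<Sum>z\<in>Z. (p * f c1 z * g c2 z) *\<^sub>R F z)
    = (\<Sum>z\<in>Z. (p * (\<Sum>c1\<in>C1. f c1 z) * (\<Sum>c2\<in>C2. g c2 z)) *\<^sub>R F z)"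
proof -
  have "(\<Sum>c1\<in>C1. \<Sum>c2\<in>C2. \<Sum>z\<in>Z. (p * f c1 z * g c2 z) *\<^sub>R F z)
      = (\<Sum>z\<in>Z. \<Sum>c1\<in>C1. \<Sum>c2\<in>C2. (p * f c1 z * g c2 z) *\<^sub>R F z)"
    by (rule sum_swap3)
  also have "\<dots> = (\<Sum>z\<in>Z. (p * (\<Sum>c1\<in>C1. f c1 z) * (\<Sum>c2\<in>C2. g c2 z)) *\<^sub>R F z)"
    unfolding mult.assoc sum_product unfolding sum_distrib_left scaleR_sum_left ..
  finally show ?thesis .
qed

lemma sum_UNIV_prod: "(\<Sum>s\<in>UNIV. f s) = (\<Sum>a\<in>UNIV. \<Sum>b\<in>UNIV. f (a, b))"
  by (simp add: sum.cartesian_product' flip: UNIV_Times_UNIV)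

text \<open>Merges outcomes and settings into one index \<open>z\<close>, so that the rules for
  exchanging sums treat them as a single sum.\<close>

lemma sum_quadruple:
  "(\<Sum>a\<in>UNIV. \<Sum>b\<in>UNIV. \<Sum>c\<in>UNIV. \<Sum>d\<in>UNIV. f a b c d)
    = (\<Sum>z\<in>UNIV. f (fst z) (fst (snd z)) (fst (snd (snd z))) (snd (snd (snd z))))"
  by (simp add: sum.cartesian_product' flip: UNIV_Times_UNIV)

lemma sum_range_to_nat:
  "(\<Sum>n\<in>range (to_nat :: 'l::finite \<Rightarrow> nat). f n) = (\<Sum>l\<in>UNIV. f (to_nat (l :: 'l)))"
  by (simp add: sum.reindex)

text \<open>The natural variables here are strategies and response functions; \<open>to_nat\<close>
  transports such finite types into the sets of natural numbers that the definition
  requires.\<close>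

lemma LOSR_convertibleI:
  fixes p :: "'l::finite \<Rightarrow> real"
    and q1 :: "'x1'::finite \<Rightarrow> 'l \<Rightarrow> 'c1::finite \<times> 'x1::finite \<Rightarrow> real" and q2 :: "'x2'::finite \<Rightarrow> 'l \<Rightarrow> 'c2::finite \<times> 'x2::finite \<Rightarrow> real"
    and \<sigma> :: "'a1::finite \<Rightarrow> 'a2::finite \<Rightarrow> 'x1::finite \<Rightarrow> 'x2::finite \<Rightarrow> complex ^ 'b ^ 'b"
    and \<sigma>' :: "'a1'::finite \<Rightarrow> 'a2'::finite \<Rightarrow> 'x1'::finite \<Rightarrow> 'x2'::finite \<Rightarrow> complex ^ 'c ^ 'c"
  assumes "prob_dist_on UNIV p"
    and "\<And>x l. prob_dist_on UNIV (q1 x l)" "\<And>x l. prob_dist_on UNIV (q2 x l)"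
    and "\<And>a c. prob_dist_on UNIV (r1 a c)" "\<And>a c. prob_dist_on UNIV (r2 a c)"
    and "\<And>l. cptp (E l)"
    and "\<And>a1' a2' x1' x2'. \<sigma>' a1' a2' x1' x2' =
           (\<Sum>l\<in>UNIV. \<Sum>c1\<in>UNIV. \<Sum>c2\<in>UNIV.
            \<Sum>a1\<in>UNIV. \<Sum>a2\<in>UNIV. \<Sum>x1\<in>UNIV. \<Sum>x2\<in>UNIV.
              (p l * q1 x1' l (c1, x1) * q2 x2' l (c2, x2) * r1 a1 c1 a1' * r2 a2 c2 a2')
                *\<^sub>R E l (\<sigma> a1 a2 x1 x2))"
  shows "LOSR_convertible \<sigma> \<sigma>'"
  unfolding LOSR_convertible_def
proof (intro exI conjI allI ballI)
  let ?p = "\<lambda>l. p (from_nat l)"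
  let ?q1 = "\<lambda>x l (c, y). q1 x (from_nat l) (from_nat c, y)"
  let ?q2 = "\<lambda>x l (c, y). q2 x (from_nat l) (from_nat c, y)"
  let ?r1 = "\<lambda>a c. r1 a (from_nat c)"
  let ?r2 = "\<lambda>a c. r2 a (from_nat c)"
  let ?E = "\<lambda>l. E (from_nat l)"
  show "finite (range (to_nat :: 'l \<Rightarrow> nat))" "finite (range (to_nat :: 'c1 \<Rightarrow> nat))"
    "finite (range (to_nat :: 'c2 \<Rightarrow> nat))" by simp_all
  show "prob_dist_on (range (to_nat :: 'l \<Rightarrow> nat)) ?p"
    using assms(1) by (simp add: prob_dist_on_def sum_range_to_nat)
  show "prob_dist_on (range (to_nat :: 'c1 \<Rightarrow> nat) \<times> UNIV) (?q1 x l)" for x l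
    using assms(2)[of x "from_nat l"]
    by (auto simp: prob_dist_on_def sum.cartesian_product' sum_range_to_nat simp flip: UNIV_Times_UNIV)
  show "prob_dist_on (range (to_nat :: 'c2 \<Rightarrow> nat) \<times> UNIV) (?q2 x l)" for x l
    using assms(3)[of x "from_nat l"]
    by (auto simp: prob_dist_on_def sum.cartesian_product' sum_range_to_nat simp flip: UNIV_Times_UNIV)
  show "prob_dist_on UNIV (?r1 a c)" "prob_dist_on UNIV (?r2 a' c)" for a a' c
    using assms(4,5) by auto
  show "cptp (?E l)" for l
    by (rule assms(6))
  show "\<sigma>' a1' a2' x1' x2' =
           (\<Sum>l\<in>range (to_nat :: 'l \<Rightarrow> nat). \<Sum>c1\<in>range (to_nat :: 'c1 \<Rightarrow> nat). \<Sum>c2\<in>range (to_nat :: 'c2 \<Rightarrow> nat).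
            \<Sum>a1\<in>UNIV. \<Sum>a2\<in>UNIV. \<Sum>x1\<in>UNIV. \<Sum>x2\<in>UNIV.
              (?p l * ?q1 x1' l (c1, x1) * ?q2 x2' l (c2, x2) * ?r1 a1 c1 a1' * ?r2 a2 c2 a2')
                *\<^sub>R ?E l (\<sigma> a1 a2 x1 x2))" for a1' a2' x1' x2'
    unfolding sum_range_to_nat by (simp add: assms(7))
qed

lemma LOSR_convertible_imp_program:
  fixes \<sigma> :: "'a1::finite \<Rightarrow> 'a2::finite \<Rightarrow> 'x1::finite \<Rightarrow> 'x2::finite \<Rightarrow> complex ^ 'b ^ 'b"
    and \<sigma>' :: "'a1'::finite \<Rightarrow> 'a2'::finite \<Rightarrow> 'x1'::finite \<Rightarrow> 'x2'::finite \<Rightarrow> complex ^ 'c ^ 'c"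
  assumes "LOSR_convertible \<sigma> \<sigma>'"
  obtains W :: "('a1, 'x1, 'a1', 'x1') strategy \<times> ('a2, 'x2, 'a2', 'x2') strategy \<Rightarrow>
          complex ^ ('b \<times> 'c) ^ ('b \<times> 'c)" and t
  where "\<And>s. psd (W s)" "\<And>s. trace_snd (W s) = (t s / CARD('b)) *\<^sub>R mat 1" "sum t UNIV = 1"
    "\<And>a1' a2' x1' x2'. \<sigma>' a1' a2' x1' x2' =
        (\<Sum>s\<in>UNIV. \<Sum>a1\<in>UNIV. \<Sum>a2\<in>UNIV. \<Sum>x1\<in>UNIV. \<Sum>x2\<in>UNIV.
          (D_outcome (fst s) a1' a1 x1' * D_setting (fst s) x1 x1' *
           D_outcome (snd s) a2' a2 x2' * D_setting (snd s) x2 x2' * real CARD('b))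
            *\<^sub>R choi_map (W s) (\<sigma> a1 a2 x1 x2))"
proof -
  obtain L C1 C2 :: "nat set" and p :: "nat \<Rightarrow> real"
    and q1 :: "'x1' \<Rightarrow> nat \<Rightarrow> nat \<times> 'x1 \<Rightarrow> real" and q2 :: "'x2' \<Rightarrow> nat \<Rightarrow> nat \<times> 'x2 \<Rightarrow> real"
    and r1 :: "'a1 \<Rightarrow> nat \<Rightarrow> 'a1' \<Rightarrow> real" and r2 :: "'a2 \<Rightarrow> nat \<Rightarrow> 'a2' \<Rightarrow> real"
    and E :: "nat \<Rightarrow> complex ^ 'b ^ 'b \<Rightarrow> complex ^ 'c ^ 'c"
    where p: "prob_dist_on L p"
      and q1 [rule_format]: "\<forall>x. \<forall>l\<in>L. prob_dist_on (C1 \<times> UNIV) (q1 x l)"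
      and q2 [rule_format]: "\<forall>x. \<forall>l\<in>L. prob_dist_on (C2 \<times> UNIV) (q2 x l)"
      and r1 [rule_format]: "\<forall>a. \<forall>c\<in>C1. prob_dist_on UNIV (r1 a c)"
      and r2 [rule_format]: "\<forall>a. \<forall>c\<in>C2. prob_dist_on UNIV (r2 a c)"
      and E [rule_format]: "\<forall>l\<in>L. cptp (E l)"
      and \<sigma>' [rule_format]: "\<forall>a1' a2' x1' x2'. \<sigma>' a1' a2' x1' x2' =
           (\<Sum>l\<in>L. \<Sum>c1\<in>C1. \<Sum>c2\<in>C2.
            \<Sum>a1\<in>UNIV. \<Sum>a2\<in>UNIV. \<Sum>x1\<in>UNIV. \<Sum>x2\<in>UNIV.
              (p l * q1 x1' l (c1, x1) * q2 x2' l (c2, x2) * r1 a1 c1 a1' * r2 a2 c2 a2')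
                *\<^sub>R E l (\<sigma> a1 a2 x1 x2))"
    using assms unfolding LOSR_convertible_def by (elim exE conjE) (rule that, assumption+)
  obtain \<mu>1 :: "nat \<Rightarrow> ('a1, 'x1, 'a1', 'x1') strategy \<Rightarrow> real" where
    \<mu>1: "\<And>l s. l \<in> L \<Longrightarrow> 0 \<le> \<mu>1 l s" "\<And>l. l \<in> L \<Longrightarrow> sum (\<mu>1 l) UNIV = 1"
      "\<And>l x' x a a'. l \<in> L \<Longrightarrow> (\<Sum>c\<in>C1. q1 x' l (c, x) * r1 a c a')
         = (\<Sum>s\<in>UNIV. \<mu>1 l s * (D_outcome s a' a x' * D_setting s x x'))"
    by (rule local_boxes_deterministic_decomposition[of L C1 q1 r1], erule q1, erule r1)
      (rule that, assumption+)
  obtain \<mu>2 :: "nat \<Rightarrow> ('a2, 'x2, 'a2', 'x2') strategy \<Rightarrow> real" where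
    \<mu>2: "\<And>l s. l \<in> L \<Longrightarrow> 0 \<le> \<mu>2 l s" "\<And>l. l \<in> L \<Longrightarrow> sum (\<mu>2 l) UNIV = 1"
      "\<And>l x' x a a'. l \<in> L \<Longrightarrow> (\<Sum>c\<in>C2. q2 x' l (c, x) * r2 a c a')
         = (\<Sum>s\<in>UNIV. \<mu>2 l s * (D_outcome s a' a x' * D_setting s x x'))"
    by (rule local_boxes_deterministic_decomposition[of L C2 q2 r2], erule q2, erule r2)
      (rule that, assumption+)
  \<comment> \<open>The joint probability of \<open>l\<close> and the strategy pair
    \<open>s\<close>; given \<open>l\<close>, the two Alices choose independently. Its marginal
    \<open>t\<close> is the weight of \<open>s\<close>.\<close>
  define u where "u = (\<lambda>l s. p l * \<mu>1 l (fst s) * \<mu>2 l (snd s))"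
  define t where "t = (\<lambda>s. \<Sum>l\<in>L. u l s)"
  define W where "W = (\<lambda>s. \<Sum>l\<in>L. (u l s / CARD('b)) *\<^sub>R choi_matrix (E l))"
  have u_nonneg: "0 \<le> u l s" if "l \<in> L" for l s
    using p \<mu>1 \<mu>2 that by (simp add: u_def prob_dist_on_def)
  show ?thesis
  proof
    show "psd (W s)" for s
      unfolding W_def
      by (intro psd_sum psd_scaleR psd_choi_matrix divide_nonneg_nonneg u_nonneg of_nat_0_le_iff)
        (use E in \<open>auto simp: cptp_def\<close>)
    show "trace_snd (W s) = (t s / CARD('b)) *\<^sub>R mat 1" for s
      using E by (simp add: W_def t_def trace_snd_sum trace_snd_scaleR trace_snd_choi_matrix
          sum_divide_distrib scaleR_sum_left)
    have "sum t UNIV = (\<Sum>l\<in>L. \<Sum>s\<in>UNIV. u l s)"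
      unfolding t_def by (rule sum.swap)
    also have "\<dots> = (\<Sum>l\<in>L. p l * (sum (\<mu>1 l) UNIV * sum (\<mu>2 l) UNIV))"
      unfolding sum_product unfolding sum_distrib_left
      by (simp add: u_def sum.cartesian_product case_prod_unfold mult.assoc)
    also have "\<dots> = 1"
      using p \<mu>1(2) \<mu>2(2) by (simp add: prob_dist_on_def)
    finally show "sum t UNIV = 1" .
    fix a1' :: 'a1' and a2' :: 'a2' and x1' :: 'x1' and x2' :: 'x2'
    let ?G = "\<lambda>l z. E l (\<sigma> (fst z) (fst (snd z)) (fst (snd (snd z))) (snd (snd (snd z))))"
    let ?D1 = "\<lambda>s z. D_outcome s a1' (fst z) x1' * D_setting s (fst (snd (snd z))) x1'"
    let ?D2 = "\<lambda>s z. D_outcome s a2' (fst (snd z)) x2' * D_setting s (snd (snd (snd z))) x2'"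
    have choi_W: "choi_map (W s) X = (\<Sum>l\<in>L. (u l s / CARD('b)) *\<^sub>R E l X)" for s X
      using E by (simp add: W_def choi_map_sum choi_map_scaleR choi_map_choi_matrix
          cptp_def completely_positive_def)
    \<comment> \<open>The factors are regrouped by Alice, so that each message sum becomes one local
      box.\<close>
    have "\<sigma>' a1' a2' x1' x2' = (\<Sum>l\<in>L. \<Sum>c1\<in>C1. \<Sum>c2\<in>C2. \<Sum>z\<in>UNIV.
        (p l * (q1 x1' l (c1, fst (snd (snd z))) * r1 (fst z) c1 a1')
             * (q2 x2' l (c2, snd (snd (snd z))) * r2 (fst (snd z)) c2 a2')) *\<^sub>R ?G l z)"
      unfolding \<sigma>' sum_quadruple by (simp add: mult_ac)
    also have "\<dots> = (\<Sum>l\<in>L. \<Sum>z\<in>UNIV. (p l * (\<Sum>s\<in>UNIV. \<mu>1 l s * ?D1 s z) * (\<Sum>s\<in>UNIV. \<mu>2 l s * ?D2 s z))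
        *\<^sub>R ?G l z)"
      unfolding sum_scaleR_product using \<mu>1(3) \<mu>2(3) by simp
    also have "\<dots> = (\<Sum>l\<in>L. \<Sum>s1\<in>UNIV. \<Sum>s2\<in>UNIV. \<Sum>z\<in>UNIV.
        (p l * (\<mu>1 l s1 * ?D1 s1 z) * (\<mu>2 l s2 * ?D2 s2 z)) *\<^sub>R ?G l z)"
      unfolding sum_scaleR_product ..
    also have "\<dots> = (\<Sum>l\<in>L. \<Sum>s\<in>UNIV. \<Sum>z\<in>UNIV. (u l s * ?D1 (fst s) z * ?D2 (snd s) z) *\<^sub>R ?G l z)"
      by (intro sum.cong[OF refl] trans[OF _ sum_UNIV_prod[symmetric]]) (simp add: u_def mult_ac)
    \<comment> \<open>Only \<open>u\<close> and the channel depend on \<open>l\<close>, so the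
      innermost sum is the map of \<open>W s\<close>, up to the factor \<open>d_B\<close>.\<close>
    also have "\<dots> = (\<Sum>s\<in>UNIV. \<Sum>z\<in>UNIV. \<Sum>l\<in>L. (u l s * ?D1 (fst s) z * ?D2 (snd s) z) *\<^sub>R ?G l z)"
      by (rule sum_swap3[symmetric])
    also have "\<dots> = (\<Sum>s\<in>UNIV. \<Sum>a1\<in>UNIV. \<Sum>a2\<in>UNIV. \<Sum>x1\<in>UNIV. \<Sum>x2\<in>UNIV.
          (D_outcome (fst s) a1' a1 x1' * D_setting (fst s) x1 x1' *
           D_outcome (snd s) a2' a2 x2' * D_setting (snd s) x2 x2' * real CARD('b))
            *\<^sub>R choi_map (W s) (\<sigma> a1 a2 x1 x2))"
      unfolding sum_quadruple choi_W scaleR_sum_right by (intro sum.cong refl) simp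
    finally show "\<sigma>' a1' a2' x1' x2' = \<dots>" .
  qed
qed

text \<open>The shared variable is the strategy pair itself, drawn with probability
  \<open>t s\<close>, and Bob applies the channel normalised from \<open>W s\<close>.\<close>

lemma program_imp_LOSR_convertible:
  fixes \<sigma> :: "'a1::finite \<Rightarrow> 'a2::finite \<Rightarrow> 'x1::finite \<Rightarrow> 'x2::finite \<Rightarrow> complex ^ 'b ^ 'b"
    and \<sigma>' :: "'a1'::finite \<Rightarrow> 'a2'::finite \<Rightarrow> 'x1'::finite \<Rightarrow> 'x2'::finite \<Rightarrow> complex ^ 'c ^ 'c"
    and W :: "('a1, 'x1, 'a1', 'x1') strategy \<times> ('a2, 'x2, 'a2', 'x2') strategy \<Rightarrow>
          complex ^ ('b \<times> 'c) ^ ('b \<times> 'c)"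
  assumes W: "\<And>s. psd (W s)" "\<And>s. trace_snd (W s) = (t s / CARD('b)) *\<^sub>R mat 1"
    and t: "\<And>s. 0 \<le> t s" "sum t UNIV = 1"
    and \<sigma>': "\<And>a1' a2' x1' x2'. \<sigma>' a1' a2' x1' x2' =
        (\<Sum>s\<in>UNIV. \<Sum>a1\<in>UNIV. \<Sum>a2\<in>UNIV. \<Sum>x1\<in>UNIV. \<Sum>x2\<in>UNIV.
          (D_outcome (fst s) a1' a1 x1' * D_setting (fst s) x1 x1' *
           D_outcome (snd s) a2' a2 x2' * D_setting (snd s) x2 x2' * real CARD('b))
            *\<^sub>R choi_map (W s) (\<sigma> a1 a2 x1 x2))"
  shows "LOSR_convertible \<sigma> \<sigma>'"
proof -
  have "\<forall>s. \<exists>E. cptp E \<and> (\<forall>X. t s *\<^sub>R E X = real CARD('b) *\<^sub>R choi_map (W s) X)"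
    using choi_map_normalized[OF W(1) t(1) W(2)] by metis
  then obtain E where E: "\<And>s. cptp (E s)"
    and tE: "\<And>s X. t s *\<^sub>R E s X = real CARD('b) *\<^sub>R choi_map (W s) X"
    by metis
  \<comment> \<open>The output stage sees only \<open>a\<close> and the message, neither
    \<open>x'\<close> nor \<open>s\<close>. The message is therefore the whole response function for
    \<open>x'\<close>, which \<open>r1\<close> evaluates at \<open>a\<close>.\<close>
  define q1 where "q1 = (\<lambda>x' (s :: ('a1, 'x1, 'a1', 'x1') strategy \<times> ('a2, 'x2, 'a2', 'x2') strategy) y.
    if y = ((\<lambda>a. fst (fst s) (a, x')), snd (fst s) x') then 1 else 0 :: real)"
  define q2 where "q2 = (\<lambda>x' (s :: ('a1, 'x1, 'a1', 'x1') strategy \<times> ('a2, 'x2, 'a2', 'x2') strategy) y.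
    if y = ((\<lambda>a. fst (snd s) (a, x')), snd (snd s) x') then 1 else 0 :: real)"
  define r1 where "r1 = (\<lambda>a (c :: 'a1 \<Rightarrow> 'a1') a'. if a' = c a then 1 else 0 :: real)"
  define r2 where "r2 = (\<lambda>a (c :: 'a2 \<Rightarrow> 'a2') a'. if a' = c a then 1 else 0 :: real)"
  have qr1: "(\<Sum>c\<in>UNIV. q1 x' s (c, x) * r1 a c a') = D_outcome (fst s) a' a x' * D_setting (fst s) x x'"
    for x' s x a a'
  proof -
    have "(\<Sum>c\<in>UNIV. q1 x' s (c, x) * r1 a c a')
      = (\<Sum>c\<in>UNIV. if c = (\<lambda>a. fst (fst s) (a, x')) then D_outcome (fst s) a' a x' * D_setting (fst s) x x' else 0)"
      by (rule sum.cong) (auto simp: q1_def r1_def D_outcome_def D_setting_def)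
    then show ?thesis by simp
  qed
  have qr2: "(\<Sum>c\<in>UNIV. q2 x' s (c, x) * r2 a c a') = D_outcome (snd s) a' a x' * D_setting (snd s) x x'"
    for x' s x a a'
  proof -
    have "(\<Sum>c\<in>UNIV. q2 x' s (c, x) * r2 a c a')
      = (\<Sum>c\<in>UNIV. if c = (\<lambda>a. fst (snd s) (a, x')) then D_outcome (snd s) a' a x' * D_setting (snd s) x x' else 0)"
      by (rule sum.cong) (auto simp: q2_def r2_def D_outcome_def D_setting_def)
    then show ?thesis by simp
  qed
  show ?thesis
  proof (rule LOSR_convertibleI)
    show "prob_dist_on UNIV t"
      using t by (simp add: prob_dist_on_def)
    show "prob_dist_on UNIV (q1 x s)" "prob_dist_on UNIV (q2 x' s)" for x x' s
      by (simp_all add: q1_def q2_def prob_dist_on_def)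
    show "prob_dist_on UNIV (r1 a c)" "prob_dist_on UNIV (r2 a' c')" for a c a' c'
      by (simp_all add: r1_def r2_def prob_dist_on_def)
    show "cptp (E s)" for s
      by (rule E)
    fix a1' :: 'a1' and a2' :: 'a2' and x1' :: 'x1' and x2' :: 'x2'
    let ?S = "\<lambda>z. \<sigma> (fst z) (fst (snd z)) (fst (snd (snd z))) (snd (snd (snd z)))"
    let ?D1 = "\<lambda>s z. D_outcome (fst s) a1' (fst z) x1' * D_setting (fst s) (fst (snd (snd z))) x1'"
    let ?D2 = "\<lambda>s z. D_outcome (snd s) a2' (fst (snd z)) x2' * D_setting (snd s) (snd (snd (snd z))) x2'"
    have "\<sigma>' a1' a2' x1' x2'
        = (\<Sum>s\<in>UNIV. \<Sum>z\<in>UNIV. (?D1 s z * ?D2 s z) *\<^sub>R (real CARD('b) *\<^sub>R choi_map (W s) (?S z)))"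
      unfolding \<sigma>' sum_quadruple by (simp add: mult_ac)
    also have "\<dots> = (\<Sum>s\<in>UNIV. \<Sum>z\<in>UNIV. (t s * ?D1 s z * ?D2 s z) *\<^sub>R E s (?S z))"
      unfolding tE[symmetric] by (simp add: mult_ac)
    \<comment> \<open>The message sums are reinserted: for given \<open>s\<close> and
      \<open>x'\<close>, exactly one message of each Alice has nonzero probability.\<close>
    also have "\<dots> = (\<Sum>s\<in>UNIV. \<Sum>c1\<in>UNIV. \<Sum>c2\<in>UNIV. \<Sum>z\<in>UNIV.
        (t s * (q1 x1' s (c1, fst (snd (snd z))) * r1 (fst z) c1 a1')
             * (q2 x2' s (c2, snd (snd (snd z))) * r2 (fst (snd z)) c2 a2')) *\<^sub>R E s (?S z))"
      unfolding sum_scaleR_product qr1 qr2 ..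
    also have "\<dots> = (\<Sum>s\<in>UNIV. \<Sum>c1\<in>UNIV. \<Sum>c2\<in>UNIV.
            \<Sum>a1\<in>UNIV. \<Sum>a2\<in>UNIV. \<Sum>x1\<in>UNIV. \<Sum>x2\<in>UNIV.
              (t s * q1 x1' s (c1, x1) * q2 x2' s (c2, x2) * r1 a1 c1 a1' * r2 a2 c2 a2')
                *\<^sub>R E s (\<sigma> a1 a2 x1 x2))"
      unfolding sum_quadruple by (simp add: mult_ac)
    finally show "\<sigma>' a1' a2' x1' x2' = \<dots>" .
  qed
qed

theorem mainTheorem2:
  fixes \<sigma> :: "'a1::finite \<Rightarrow> 'a2::finite \<Rightarrow> 'x1::finite \<Rightarrow> 'x2::finite \<Rightarrow> complex ^ 'b ^ 'b"
    and \<sigma>' :: "'a1'::finite \<Rightarrow> 'a2'::finite \<Rightarrow> 'x1'::finite \<Rightarrow> 'x2'::finite \<Rightarrow> complex ^ 'c ^ 'c"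
  assumes "tripartite_assemblage TYPE('h1) TYPE('h2) \<sigma>"
    and "tripartite_assemblage TYPE('k1) TYPE('k2) \<sigma>'"
  shows "LOSR_convertible \<sigma> \<sigma>' \<longleftrightarrow>
    (\<exists>W :: ('a1, 'x1, 'a1', 'x1') strategy \<times> ('a2, 'x2, 'a2', 'x2') strategy \<Rightarrow>
          complex ^ ('b \<times> 'c) ^ ('b \<times> 'c).
      (\<forall>l. psd (W l)) \<and>
      (\<forall>l. \<exists>t. trace_snd (W l) = cscale t (cscale (1 / of_nat CARD('b)) (mat 1))) \<and>
      (\<Sum>l\<in>UNIV. trace_snd (W l)) = cscale (1 / of_nat CARD('b)) (mat 1) \<and>
      (\<forall>a1' a2' x1' x2'. \<sigma>' a1' a2' x1' x2' =
        (\<Sum>l\<in>UNIV. \<Sum>a1\<in>UNIV. \<Sum>a2\<in>UNIV. \<Sum>x1\<in>UNIV. \<Sum>x2\<in>UNIV.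
          (D_outcome (fst l) a1' a1 x1' * D_setting (fst l) x1 x1' *
           D_outcome (snd l) a2' a2 x2' * D_setting (snd l) x2 x2' * real CARD('b))
            *\<^sub>R trace_fst (W l ** mat_tensor (transpose (\<sigma> a1 a2 x1 x2)) (mat 1)))))"
  (is "?C \<longleftrightarrow> ?P")
proof
  \<comment> \<open>Converts the complex scaling of the statement to the real scaling used by the
    lemmas.\<close>
  have scale: "cscale (1 / of_nat CARD('b)) (mat 1) = (1 / CARD('b)) *\<^sub>R (mat 1 :: complex ^ 'b ^ 'b)"
    using cscale_of_real[of "1 / CARD('b)"] by simp
  show ?P if ?C
  proof -
    obtain W :: "('a1, 'x1, 'a1', 'x1') strategy \<times> ('a2, 'x2, 'a2', 'x2') strategy \<Rightarrow>
          complex ^ ('b \<times> 'c) ^ ('b \<times> 'c)" and t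
      where W: "\<And>s. psd (W s)" "\<And>s. trace_snd (W s) = (t s / CARD('b)) *\<^sub>R mat 1" "sum t UNIV = 1"
        and \<sigma>': "\<And>a1' a2' x1' x2'. \<sigma>' a1' a2' x1' x2' =
        (\<Sum>s\<in>UNIV. \<Sum>a1\<in>UNIV. \<Sum>a2\<in>UNIV. \<Sum>x1\<in>UNIV. \<Sum>x2\<in>UNIV.
          (D_outcome (fst s) a1' a1 x1' * D_setting (fst s) x1 x1' *
           D_outcome (snd s) a2' a2 x2' * D_setting (snd s) x2 x2' * real CARD('b))
            *\<^sub>R choi_map (W s) (\<sigma> a1 a2 x1 x2))"
      using LOSR_convertible_imp_program[OF \<open>?C\<close>] by blast
    have "trace_snd (W s) = cscale (of_real (t s)) (cscale (1 / of_nat CARD('b)) (mat 1))" for s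
      by (simp add: W scale cscale_of_real)
    moreover have "(\<Sum>s\<in>UNIV. trace_snd (W s)) = cscale (1 / of_nat CARD('b)) (mat 1)"
      unfolding scale W(2) scaleR_sum_left[symmetric] sum_divide_distrib[symmetric] W(3) ..
    ultimately show ?P
      using W(1) \<sigma>' unfolding choi_map_def by (intro exI[of _ W] conjI allI exI) assumption+
  qed
  assume ?P
  then obtain W :: "('a1, 'x1, 'a1', 'x1') strategy \<times> ('a2, 'x2, 'a2', 'x2') strategy \<Rightarrow>
          complex ^ ('b \<times> 'c) ^ ('b \<times> 'c)"
    where W [rule_format]: "\<forall>s. psd (W s)"
      and proportional [rule_format]: "\<forall>s. \<exists>t. trace_snd (W s) = cscale t (cscale (1 / of_nat CARD('b)) (mat 1))"
      and total: "(\<Sum>s\<in>UNIV. trace_snd (W s)) = cscale (1 / of_nat CARD('b)) (mat 1)"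
      and \<sigma>' [rule_format]: "\<forall>a1' a2' x1' x2'. \<sigma>' a1' a2' x1' x2' =
        (\<Sum>s\<in>UNIV. \<Sum>a1\<in>UNIV. \<Sum>a2\<in>UNIV. \<Sum>x1\<in>UNIV. \<Sum>x2\<in>UNIV.
          (D_outcome (fst s) a1' a1 x1' * D_setting (fst s) x1 x1' *
           D_outcome (snd s) a2' a2 x2' * D_setting (snd s) x2 x2' * real CARD('b))
            *\<^sub>R choi_map (W s) (\<sigma> a1 a2 x1 x2))"
    unfolding choi_map_def[symmetric] by (elim exE conjE) (rule that, assumption+)
  \<comment> \<open>Positivity of \<open>W s\<close> replaces the arbitrary complex factors by
    nonnegative weights.\<close>
  have "\<forall>s. \<exists>t\<ge>0. trace_snd (W s) = (t / CARD('b)) *\<^sub>R mat 1"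
    using W proportional psd_proportional_trace_snd by metis
  then obtain t where t: "\<And>s. 0 \<le> t s" "\<And>s. trace_snd (W s) = (t s / CARD('b)) *\<^sub>R mat 1"
    by metis
  have "(sum t UNIV / CARD('b)) *\<^sub>R (mat 1 :: complex ^ 'b ^ 'b) = (1 / CARD('b)) *\<^sub>R mat 1"
    using total unfolding scale t(2) scaleR_sum_left[symmetric] sum_divide_distrib[symmetric] .
  \<comment> \<open>One diagonal entry, at an arbitrary index, determines the total weight.\<close>
  from arg_cong[OF this, of "\<lambda>A. A $ undefined $ undefined"] have "sum t UNIV = 1"
    by (simp add: mat_def scaleR_conv_of_real[where 'a = complex] flip: of_real_sum)
  then show ?C
    using program_imp_LOSR_convertible[OF W t(2,1) _ \<sigma>'] by blast
qed

end
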